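(* Let $n,p$ be positive integers and let $\mathcal{A},\mathcal{B}\in\mathbb{H}^{n\times n\times p}_{++}$. Then $\mathcal{A}\#\mathcal{B}$ is the unique T-positive definite solution $\mathcal{X}$ of the Riccati tensor equation $\mathcal{X}*\mathcal{A}^{-1}*\mathcal{X}=\mathcal{B}$.
   Context: A tensor $\mathcal{A}\in\mathbb{C}^{m\times n\times p}$ has frontal slices $A^{(1)},\dots,A^{(p)}\in\mathbb{C}^{m\times n}$. $\operatorname{bcirc}(\mathcal{A})\in\mathbb{C}^{mp\times np}$ is the block circulant matrix whose $(j,l)$ block is $A^{(((j-l)\bmod p)+1)}$ (first block column $A^{(1)},\dots,A^{(p)}$); $\operatorname{unfold}(\mathcal{A})$ is the block column $A^{(1)},\dots,A^{(p)}$, and $\operatorname{fold}$ is its inverse. The T-product of $\mathcal{A}\in\mathbb{C}^{m\times n\times p}$ and $\mathcal{B}\in\mathbb{C}^{n\times s\times p}$ is $\mathcal{A}*\mathcal{B}=\operatorname{fold}(\operatorname{bcirc}(\mathcal{A})\cdot\operatorname{unfold}(\mathcal{B}))\in\mathbb{C}^{m\times s\times p}$. The identity tensor $\mathcal{I}_{n,p}$ has first frontal slice $I_n$ and all others zero; inverses are taken with respect to $*$ and $\mathcal{I}_{n,p}$. The T-conjugate transpose $\mathcal{A}^H$ has frontal slices $(A^{(1)})^H,(A^{(p)})^H,\dots,(A^{(2)})^H$, in this order. $\mathcal{A}\in\mathbb{C}^{n\times n\times p}$ is T-Hermitian if $\mathcal{A}^H=\mathcal{A}$; $\mathbb{H}^{n\times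 n\times p}$ is the set of these. The Frobenius inner product is $\langle\mathcal{A},\mathcal{B}\rangle=\sum_{i,j,k}\overline{a_{ijk}}b_{ijk}$. A tensor $\mathcal{A}\in\mathbb{H}^{n\times n\times p}$ is T-positive definite if $\langle\mathcal{X},\mathcal{A}*\mathcal{X}\rangle>0$ for all nonzero $\mathcal{X}\in\mathbb{C}^{n\times1\times p}$ (equivalently, $\operatorname{bcirc}(\mathcal{A})$ is Hermitian positive definite); $\mathbb{H}^{n\times n\times p}_{++}$ is the set of these. Each $\mathcal{A}\in\mathbb{H}^{n\times n\times p}_{++}$ is invertible with $\mathcal{A}^{-1}\in\mathbb{H}^{n\times n\times p}_{++}$, and has a unique T-positive definite square root $\mathcal{A}^{1/2}$; $\mathcal{A}^{-1/2}=(\mathcal{A}^{1/2})^{-1}$. The geometric mean is $\mathcal{A}\#\mathcal{B}=\mathcal{A}^{1/2}*(\mathcal{A}^{-1/2}*\mathcal{B}*\mathcal{A}^{-1/2})^{1/2}*\mathcal{A}^{1/2}$. *)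

theory Defs
  imports Complex_Main "HOL-Library.Complex_Order" "Jordan_Normal_Form.Matrix"
    "Jordan_Normal_Form.Schur_Decomposition"
begin

(* A third-order complex tensor is the list of its frontal slices. List positions and matrix
   indices start at 0, so A ! k is the slice with (1-based) number k + 1. *)
type_synonym ctensor = "complex mat list"

definition tensors :: "nat \<Rightarrow> nat \<Rightarrow> nat \<Rightarrow> ctensor set" where
  "tensors m n p = {A. length A = p \<and> set A \<subseteq> carrier_mat m n}"

(* The slice dimensions are read off the first slice, so everything built on them is only
   meaningful for members of tensors m n p with p > 0. *)
definition slice_rows :: "ctensor \<Rightarrow> nat" where
  "slice_rows A = dim_row (A ! 0)"

definition slice_cols :: "ctensor \<Rightarrow> nat" where
  "slice_cols A = dim_col (A ! 0)"

(* Block (j, l), for 0 \<le> j, l < p, is the slice at position (j - l) mod p; the summand p keeps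
   the natural-number subtraction from truncating. *)
definition bcirc :: "ctensor \<Rightarrow> complex mat" where
  "bcirc A = (let m = slice_rows A; n = slice_cols A; p = length A in
     mat (m * p) (n * p)
       (\<lambda>(r, c). (A ! ((r div m + p - c div n) mod p)) $$ (r mod m, c mod n)))"

definition tunfold :: "ctensor \<Rightarrow> complex mat" where
  "tunfold A = (let m = slice_rows A in
     mat (m * length A) (slice_cols A) (\<lambda>(r, c). (A ! (r div m)) $$ (r mod m, c)))"

definition tfold :: "nat \<Rightarrow> complex mat \<Rightarrow> ctensor" where
  "tfold p M = (let m = dim_row M div p in
     map (\<lambda>k. mat m (dim_col M) (\<lambda>(i, j). M $$ (k * m + i, j))) [0..<p])"

definition tprod :: "ctensor \<Rightarrow> ctensor \<Rightarrow> ctensor" (infixl "*\<^sub>T" 70) where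
  "A *\<^sub>T B = tfold (length A) (bcirc A * tunfold B)"

definition tid :: "nat \<Rightarrow> nat \<Rightarrow> ctensor" where
  "tid n p = map (\<lambda>k. if k = 0 then 1\<^sub>m n else 0\<^sub>m n n) [0..<p]"

definition tzero :: "nat \<Rightarrow> nat \<Rightarrow> nat \<Rightarrow> ctensor" where
  "tzero m n p = replicate p (0\<^sub>m m n)"

definition tinv :: "ctensor \<Rightarrow> ctensor" where
  "tinv A = (let n = slice_rows A; p = length A in
     THE B. B \<in> tensors n n p \<and> A *\<^sub>T B = tid n p \<and> B *\<^sub>T A = tid n p)"

definition tadjoint :: "ctensor \<Rightarrow> ctensor" where
  "tadjoint A = map (\<lambda>k. mat_adjoint (A ! ((length A - k) mod length A))) [0..<length A]"

definition t_hermitian :: "nat \<Rightarrow> nat \<Rightarrow> ctensor set" where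
  "t_hermitian n p = {A \<in> tensors n n p. tadjoint A = A}"

definition tinner :: "ctensor \<Rightarrow> ctensor \<Rightarrow> complex" where
  "tinner A B = (\<Sum>i<slice_rows A. \<Sum>j<slice_cols A. \<Sum>k<length A.
     cnj ((A ! k) $$ (i, j)) * (B ! k) $$ (i, j))"

(* In the order on complex numbers, z > 0 means that z is real and positive. *)
definition t_posdef :: "nat \<Rightarrow> nat \<Rightarrow> ctensor set" where
  "t_posdef n p = {A \<in> t_hermitian n p.
     \<forall>X \<in> tensors n 1 p. X \<noteq> tzero n 1 p \<longrightarrow> tinner X (A *\<^sub>T X) > 0}"

definition tsqrt :: "ctensor \<Rightarrow> ctensor" where
  "tsqrt A = (THE S. S \<in> t_posdef (slice_rows A) (length A) \<and> S *\<^sub>T S = A)"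

definition tgmean :: "ctensor \<Rightarrow> ctensor \<Rightarrow> ctensor" (infixl "#\<^sub>T" 70) where
  "A #\<^sub>T B = (let R = tsqrt A; R' = tinv (tsqrt A) in
     R *\<^sub>T tsqrt (R' *\<^sub>T B *\<^sub>T R') *\<^sub>T R)"

end

theory Submission
  imports Defs "Jordan_Normal_Form.Spectral_Radius"
begin

text \<open>
  The map \<open>bcirc\<close> embeds the tensors of size \<open>n \<times> n \<times> p\<close> with the T-product into the algebra of
  square matrices of size \<open>n * p\<close>. It is injective, multiplicative (\<open>bcirc_tprod\<close>), compatible
  with conjugate transposes (\<open>bcirc_tadjoint\<close>), and a tensor is T-positive definite exactly if its
  image is a positive definite matrix (\<open>t_posdef_iff_bcirc\<close>). The question thus becomes one about
  positive definite matrices, provided that inverses and square roots do not lead out of the image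
  of \<open>bcirc\<close>.

  They do not, because of uniqueness. The image consists of the block circulant matrices, which are
  the fixed points of an automorphism of the matrix algebra: cyclic renumbering of the blocks,
  applied to rows and columns at once. The automorphism preserves positive definiteness. If it
  fixes \<open>M\<close>, it therefore maps the inverse of \<open>M\<close> to an inverse of \<open>M\<close> and the positive definite
  square root of \<open>M\<close> to a positive definite square root of \<open>M\<close>; as both are unique, it fixes them
  too. This makes \<open>tinv\<close> and \<open>tsqrt\<close> meaningful (\<open>t_posdef_tinv\<close>, \<open>t_posdef_tsqrt\<close>).

  A positive definite square root of a matrix is built by splitting off one eigenvector at a time
  (\<open>posdef_sqrt_exists\<close>); a trace argument shows that it is unique (\<open>posdef_sqrt_unique\<close>).

  With \<open>R\<close> the square root of \<open>A\<close>, the substitution \<open>X = R * Y * R\<close> is a bijection of the positive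
  definite elements and turns \<open>X * A\<^sup>-\<^sup>1 * X = B\<close> into \<open>Y * Y = R\<^sup>-\<^sup>1 * B * R\<^sup>-\<^sup>1\<close>. The right hand
  side is positive definite, so there is exactly one positive definite \<open>Y\<close>, and the corresponding
  \<open>X\<close> is the geometric mean.
\<close>

section \<open>Positive definite complex matrices\<close>

lemma mat_adjoint_eq_mat:
  "mat_adjoint (A :: complex mat) = mat (dim_col A) (dim_row A) (\<lambda>(i, j). cnj (A $$ (j, i)))"
  by (rule eq_matI) (auto simp: mat_adjoint_def mat_of_rows_def)

lemma mat_adjoint_carrier [simp]:
  "(A :: complex mat) \<in> carrier_mat m n \<Longrightarrow> mat_adjoint A \<in> carrier_mat n m"
  by (auto simp: mat_adjoint_eq_mat)

lemma mat_adjoint_adjoint [simp]: "mat_adjoint (mat_adjoint (A :: complex mat)) = A"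
  by (rule eq_matI) (auto simp: mat_adjoint_eq_mat)

lemma mat_adjoint_mult:
  assumes "(A :: complex mat) \<in> carrier_mat m n" "B \<in> carrier_mat n k"
  shows "mat_adjoint (A * B) = mat_adjoint B * mat_adjoint A"
  using assms
  by (intro eq_matI) (auto simp: mat_adjoint_eq_mat scalar_prod_def intro!: sum.cong)

lemma mat_adjoint_minus:
  assumes "(A :: complex mat) \<in> carrier_mat m n" "B \<in> carrier_mat m n"
  shows "mat_adjoint (A - B) = mat_adjoint A - mat_adjoint B"
  using assms by (intro eq_matI) (auto simp: mat_adjoint_eq_mat)

lemma mat_adjoint_one [simp]: "mat_adjoint (1\<^sub>m n :: complex mat) = 1\<^sub>m n"
  by (rule eq_matI) (auto simp: mat_adjoint_eq_mat)

lemma cscalar_prod_mat_adjoint: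
  assumes "(A :: complex mat) \<in> carrier_mat m n" "x \<in> carrier_vec n" "y \<in> carrier_vec m"
  shows "(A *\<^sub>v x) \<bullet>c y = x \<bullet>c (mat_adjoint A *\<^sub>v y)"
proof -
  have "(A *\<^sub>v x) \<bullet>c y = (\<Sum>i<m. \<Sum>j<n. A $$ (i, j) * x $ j * cnj (y $ i))"
    using assms
    by (auto simp: scalar_prod_def sum_distrib_right lessThan_atLeast0 intro!: sum.cong)
  also have "\<dots> = (\<Sum>j<n. \<Sum>i<m. A $$ (i, j) * x $ j * cnj (y $ i))"
    by (rule sum.swap)
  also have "\<dots> = x \<bullet>c (mat_adjoint A *\<^sub>v y)"
    using assms
    by (auto simp: mat_adjoint_eq_mat scalar_prod_def sum_distrib_left lessThan_atLeast0
        intro!: sum.cong)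
  finally show ?thesis .
qed

definition posdef_mat :: "nat \<Rightarrow> complex mat \<Rightarrow> bool" where
  "posdef_mat N M \<longleftrightarrow> M \<in> carrier_mat N N \<and> mat_adjoint M = M \<and>
     (\<forall>v \<in> carrier_vec N. v \<noteq> 0\<^sub>v N \<longrightarrow> (M *\<^sub>v v) \<bullet>c v > 0)"

lemma posdef_matD:
  assumes "posdef_mat N M"
  shows "M \<in> carrier_mat N N" "mat_adjoint M = M"
    "\<And>v. v \<in> carrier_vec N \<Longrightarrow> v \<noteq> 0\<^sub>v N \<Longrightarrow> (M *\<^sub>v v) \<bullet>c v > 0"
  using assms by (auto simp: posdef_mat_def)

lemma posdef_mat_nonneg:
  assumes "posdef_mat N M" "v \<in> carrier_vec N"
  shows "(M *\<^sub>v v) \<bullet>c v \<ge> 0"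
proof (cases "v = 0\<^sub>v N")
  case True
  then show ?thesis using posdef_matD(1)[OF assms(1)] by simp
next
  case False
  then show ?thesis using posdef_matD(3)[OF assms] by (simp add: less_imp_le)
qed

text \<open>
  The quadratic form of \<open>U\<^sup>H M U\<close> at \<open>v\<close> is that of \<open>M\<close> at \<open>U v\<close>, and \<open>U\<close> has a left inverse, hence
  maps nonzero vectors to nonzero vectors.
\<close>
lemma posdef_mat_congruence:
  assumes M: "posdef_mat N M" and U: "U \<in> carrier_mat N N" and V: "V \<in> carrier_mat N N"
    and inv: "V * U = 1\<^sub>m N"
  shows "posdef_mat N (mat_adjoint U * M * U)"
  unfolding posdef_mat_def
proof (intro conjI ballI impI)
  note Mc = posdef_matD(1)[OF M]
  have Ua: "mat_adjoint U \<in> carrier_mat N N" using U by simp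
  show "mat_adjoint U * M * U \<in> carrier_mat N N" using Mc U by (simp add: mult_carrier_mat[of _ N N _ N])
  show "mat_adjoint (mat_adjoint U * M * U) = mat_adjoint U * M * U"
    using U Ua Mc posdef_matD(2)[OF M]
    by (simp add: mat_adjoint_mult[of _ N N _ N] assoc_mult_mat[of _ N N _ N _ N])
  fix v :: "complex vec" assume v: "v \<in> carrier_vec N" and v0: "v \<noteq> 0\<^sub>v N"
  have "V *\<^sub>v (U *\<^sub>v v) = v"
    using assoc_mult_mat_vec[OF V U v] inv v by simp
  moreover have "V *\<^sub>v 0\<^sub>v N = 0\<^sub>v N" using V by (intro eq_vecI) auto
  ultimately have "U *\<^sub>v v \<noteq> 0\<^sub>v N" using v0 by metis
  then have "(M *\<^sub>v (U *\<^sub>v v)) \<bullet>c (U *\<^sub>v v) > 0"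
    using posdef_matD(3)[OF M] U v by simp
  also have "(M *\<^sub>v (U *\<^sub>v v)) \<bullet>c (U *\<^sub>v v)
      = (mat_adjoint U *\<^sub>v (M *\<^sub>v (U *\<^sub>v v))) \<bullet>c v"
    using cscalar_prod_mat_adjoint[of "mat_adjoint U" N N "M *\<^sub>v (U *\<^sub>v v)" v] U Mc v by simp
  also have "mat_adjoint U *\<^sub>v (M *\<^sub>v (U *\<^sub>v v)) = (mat_adjoint U * M * U) *\<^sub>v v"
    using U Mc v by (simp add: assoc_mult_mat_vec[of _ N N _ N] mult_carrier_mat[of _ N N _ N])
  finally show "((mat_adjoint U * M * U) *\<^sub>v v) \<bullet>c v > 0" .
qed

text \<open>
  A kernel vector of \<open>M\<close> would be a zero of the quadratic form, so \<open>M\<close> has an inverse \<open>W\<close>. As \<open>M\<close> is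
  Hermitian, \<open>W\<^sup>H M = 1\<close> and therefore \<open>W = W\<^sup>H M W\<close>: the inverse is congruent to \<open>M\<close>.
\<close>
lemma posdef_mat_inverse:
  assumes M: "posdef_mat N M"
  obtains W where "posdef_mat N W" "W * M = 1\<^sub>m N" "M * W = 1\<^sub>m N"
proof -
  note Mc = posdef_matD(1)[OF M]
  have "det M \<noteq> 0"
  proof
    assume "det M = 0"
    then obtain v where v: "v \<in> carrier_vec N" "v \<noteq> 0\<^sub>v N" "M *\<^sub>v v = 0\<^sub>v N"
      using det_0_iff_vec_prod_zero_field[OF Mc] by auto
    then show False using posdef_matD(3)[OF M v(1,2)] by simp
  qed
  from det_non_zero_imp_unit[OF Mc this, of "()"]
  obtain W where W: "W \<in> carrier_mat N N" and WM: "W * M = 1\<^sub>m N" and MW: "M * W = 1\<^sub>m N"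
    by (auto simp: Units_def ring_mat_def)
  have Wa: "mat_adjoint W \<in> carrier_mat N N" using W by simp
  have WaM: "mat_adjoint W * M = 1\<^sub>m N"
    using mat_adjoint_mult[OF Mc W] posdef_matD(2)[OF M] MW by simp
  have "posdef_mat N (mat_adjoint W * M * W)"
    by (rule posdef_mat_congruence[OF M W Mc MW])
  then have "posdef_mat N W" using WaM W by simp
  then show thesis using that WM MW by blast
qed

section \<open>Square roots of positive definite matrices\<close>

lemma index_mult_mat_sum:
  assumes "(A :: 'a :: semiring_0 mat) \<in> carrier_mat m n" "B \<in> carrier_mat n k" "i < m" "j < k"
  shows "(A * B) $$ (i, j) = (\<Sum>l<n. A $$ (i, l) * B $$ (l, j))"
  using assms by (auto simp: scalar_prod_def lessThan_atLeast0 intro!: sum.cong)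

definition mat_trace :: "complex mat \<Rightarrow> complex" where
  "mat_trace A = (\<Sum>i<dim_row A. A $$ (i, i))"

lemma mat_trace_commute:
  assumes "A \<in> carrier_mat m n" "B \<in> carrier_mat n m"
  shows "mat_trace (A * B) = mat_trace (B * A)"
proof -
  have "mat_trace (A * B) = (\<Sum>i<m. \<Sum>j<n. A $$ (i, j) * B $$ (j, i))"
    using assms by (auto simp: mat_trace_def scalar_prod_def lessThan_atLeast0 intro!: sum.cong)
  also have "\<dots> = (\<Sum>j<n. \<Sum>i<m. A $$ (i, j) * B $$ (j, i))"
    by (rule sum.swap)
  also have "\<dots> = mat_trace (B * A)"
    using assms
    by (auto simp: mat_trace_def scalar_prod_def lessThan_atLeast0 mult.commute intro!: sum.cong)
  finally show ?thesis .
qed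

text \<open>
  The diagonal entries of \<open>D\<^sup>H S D\<close> are the values of the quadratic form of \<open>S\<close> at the columns of \<open>D\<close>.
\<close>
lemma mat_trace_congruence:
  assumes "S \<in> carrier_mat N N" "D \<in> carrier_mat N N"
  shows "mat_trace (mat_adjoint D * (S * D)) = (\<Sum>j<N. (S *\<^sub>v col D j) \<bullet>c col D j)"
  using assms
  by (auto simp: mat_trace_def scalar_prod_def mat_adjoint_eq_mat lessThan_atLeast0 mult.commute
      intro!: sum.cong)

text \<open>
  The difference \<open>D = S - T\<close> satisfies \<open>S D + D T = S\<^sup>2 - T\<^sup>2 = 0\<close>, a form of the difference of squares
  that holds although \<open>S\<close> and \<open>T\<close> need not commute. Multiplication by \<open>D\<close> from the right and the
  cyclic invariance of the trace give \<open>tr (D S D) + tr (D T D) = 0\<close>. Since \<open>D\<close> is Hermitian, both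
  traces are sums of values of positive definite forms at the columns of \<open>D\<close>, so all columns vanish.
\<close>
lemma posdef_sqrt_unique:
  assumes S: "posdef_mat N S" and T: "posdef_mat N T" and eq: "S * S = T * T"
  shows "S = T"
proof -
  note Sc = posdef_matD(1)[OF S] and Tc = posdef_matD(1)[OF T]
  define D where "D = S - T"
  have Dc: "D \<in> carrier_mat N N" unfolding D_def using Tc by (rule minus_carrier_mat)
  have Da: "mat_adjoint D = D"
    unfolding D_def using mat_adjoint_minus[OF Sc Tc] posdef_matD(2)[OF S] posdef_matD(2)[OF T]
    by simp
  have sum0: "S * D + D * T = 0\<^sub>m N N"
    unfolding D_def
    using Sc Tc eq
    by (simp add: mult_minus_distrib_mat[of _ N N _ N] minus_mult_distrib_mat[of _ N N _ _ N])
       (auto intro!: eq_matI)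
  have "mat_trace (D * (S * D)) + mat_trace (D * (T * D)) = 0"
  proof -
    have "mat_trace (D * (S * D)) = mat_trace (S * D * D)"
      using mat_trace_commute[of D N N "S * D"] Sc Dc by simp
    moreover have "mat_trace (D * (T * D)) = mat_trace (D * T * D)"
      using assoc_mult_mat[OF Dc Tc Dc] by simp
    moreover have "mat_trace (S * D * D) + mat_trace (D * T * D)
        = mat_trace ((S * D + D * T) * D)"
      using Sc Tc Dc
      by (subst add_mult_distrib_mat[of _ N N _ _ N]) (auto simp: mat_trace_def sum.distrib)
    moreover have "mat_trace ((S * D + D * T) * D) = 0"
      unfolding sum0 using Dc by (simp add: mat_trace_def)
    ultimately show ?thesis by simp
  qed
  then have "(\<Sum>j<N. (S *\<^sub>v col D j) \<bullet>c col D j) + (\<Sum>j<N. (T *\<^sub>v col D j) \<bullet>c col D j) = 0"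
    using mat_trace_congruence[OF Sc Dc] mat_trace_congruence[OF Tc Dc] Da by simp
  moreover have Snn: "(S *\<^sub>v col D j) \<bullet>c col D j \<ge> 0"
    and Tnn: "(T *\<^sub>v col D j) \<bullet>c col D j \<ge> 0" if "j < N" for j
    using posdef_mat_nonneg[OF S] posdef_mat_nonneg[OF T] Dc that by auto
  then have "(\<Sum>j<N. (S *\<^sub>v col D j) \<bullet>c col D j) \<ge> 0" "(\<Sum>j<N. (T *\<^sub>v col D j) \<bullet>c col D j) \<ge> 0"
    by (auto intro!: sum_nonneg)
  ultimately have "(\<Sum>j<N. (S *\<^sub>v col D j) \<bullet>c col D j) = 0"
    using add_nonneg_eq_0_iff by blast
  then have zero: "(S *\<^sub>v col D j) \<bullet>c col D j = 0" if "j < N" for j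
    using Snn that by (subst (asm) sum_nonneg_eq_0_iff) auto
  have colD: "col D j = 0\<^sub>v N" if "j < N" for j
  proof (rule ccontr)
    assume "col D j \<noteq> 0\<^sub>v N"
    then have "(S *\<^sub>v col D j) \<bullet>c col D j > 0"
      using posdef_matD(3)[OF S] Dc that by auto
    then show False using zero[OF that] by simp
  qed
  show "S = T"
  proof (rule eq_matI)
    fix i j assume ij: "i < dim_row T" "j < dim_col T"
    have "D $$ (i, j) = col D j $ i" using Dc Tc ij by auto
    also have "\<dots> = 0" using colD[of j] ij Tc by simp
    finally show "S $$ (i, j) = T $$ (i, j)" using Sc Tc ij by (simp add: D_def)
  qed (use Sc Tc in auto)
qed

lemma posdef_mat_four_block_diag:
  assumes A: "A \<in> carrier_mat k k" and D: "D \<in> carrier_mat l l"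
  shows "posdef_mat (k + l) (four_block_mat A (0\<^sub>m k l) (0\<^sub>m l k) D)
    \<longleftrightarrow> posdef_mat k A \<and> posdef_mat l D" (is "posdef_mat _ ?M \<longleftrightarrow> _")
proof -
  have Mc: "?M \<in> carrier_mat (k + l) (k + l)" using A D by simp
  have adj: "mat_adjoint ?M
      = four_block_mat (mat_adjoint A) (0\<^sub>m k l) (0\<^sub>m l k) (mat_adjoint D)"
    using A D by (intro eq_matI) (auto simp: mat_adjoint_eq_mat)
  have form: "(?M *\<^sub>v (a @\<^sub>v d)) \<bullet>c (a @\<^sub>v d) = (A *\<^sub>v a) \<bullet>c a + (D *\<^sub>v d) \<bullet>c d"
    if "a \<in> carrier_vec k" "d \<in> carrier_vec l" for a d
  proof -
    have "conjugate (a @\<^sub>v d) = conjugate a @\<^sub>v conjugate d"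
      using that by (intro eq_vecI) auto
    then show ?thesis
      using A D that
      by (simp add: mult_mat_vec_split[of _ k _ l] scalar_prod_append[of _ k _ l]
          mult_mat_vec_carrier[of _ k k] mult_mat_vec_carrier[of _ l l])
  qed
  have zero: "a @\<^sub>v d = 0\<^sub>v (k + l) \<longleftrightarrow> a = 0\<^sub>v k \<and> d = 0\<^sub>v l"
    if "a \<in> carrier_vec k" "d \<in> carrier_vec l" for a d :: "complex vec"
  proof -
    have "0\<^sub>v k @\<^sub>v 0\<^sub>v l = (0\<^sub>v (k + l) :: complex vec)" by (intro eq_vecI) auto
    then show ?thesis using append_vec_eq[OF that(1), of "0\<^sub>v k" d "0\<^sub>v l"] by auto
  qed
  show ?thesis
  proof
    assume M: "posdef_mat (k + l) ?M"
    have ent: "mat_adjoint ?M $$ (i, j) = ?M $$ (i, j)" for i j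
      using posdef_matD(2)[OF M] by simp
    have "mat_adjoint A = A"
    proof (rule eq_matI)
      fix i j assume "i < dim_row A" "j < dim_col A"
      then show "mat_adjoint A $$ (i, j) = A $$ (i, j)"
        using ent[of i j] A D by (simp add: adj mat_adjoint_eq_mat)
    qed (use A in \<open>auto simp: mat_adjoint_eq_mat\<close>)
    moreover have "mat_adjoint D = D"
    proof (rule eq_matI)
      fix i j assume "i < dim_row D" "j < dim_col D"
      then show "mat_adjoint D $$ (i, j) = D $$ (i, j)"
        using ent[of "k + i" "k + j"] A D by (simp add: adj mat_adjoint_eq_mat)
    qed (use D in \<open>auto simp: mat_adjoint_eq_mat\<close>)
    moreover have "(A *\<^sub>v a) \<bullet>c a > 0" if "a \<in> carrier_vec k" "a \<noteq> 0\<^sub>v k" for a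
      using posdef_matD(3)[OF M, of "a @\<^sub>v 0\<^sub>v l"] zero[of a "0\<^sub>v l"] form[of a "0\<^sub>v l"] that D
      by simp
    moreover have "(D *\<^sub>v d) \<bullet>c d > 0" if "d \<in> carrier_vec l" "d \<noteq> 0\<^sub>v l" for d
      using posdef_matD(3)[OF M, of "0\<^sub>v k @\<^sub>v d"] zero[of "0\<^sub>v k" d] form[of "0\<^sub>v k" d] that A
      by simp
    ultimately show "posdef_mat k A \<and> posdef_mat l D"
      using A D by (simp add: posdef_mat_def)
  next
    assume "posdef_mat k A \<and> posdef_mat l D"
    then have PA: "posdef_mat k A" and PD: "posdef_mat l D" by auto
    have "(?M *\<^sub>v (a @\<^sub>v d)) \<bullet>c (a @\<^sub>v d) > 0"
      if a: "a \<in> carrier_vec k" and d: "d \<in> carrier_vec l" and "a @\<^sub>v d \<noteq> 0\<^sub>v (k + l)" for a d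
    proof -
      have "a \<noteq> 0\<^sub>v k \<or> d \<noteq> 0\<^sub>v l" using zero[OF a d] that(3) by auto
      then show ?thesis
        unfolding form[OF a d]
        using posdef_matD(3)[OF PA a] posdef_matD(3)[OF PD d]
          posdef_mat_nonneg[OF PA a] posdef_mat_nonneg[OF PD d]
        by (auto intro: add_pos_nonneg add_nonneg_pos)
    qed
    then have "\<forall>v \<in> carrier_vec (k + l). v \<noteq> 0\<^sub>v (k + l) \<longrightarrow> (?M *\<^sub>v v) \<bullet>c v > 0"
      by (subst all_vec_append) blast
    then show "posdef_mat (k + l) ?M"
      using Mc adj posdef_matD(2)[OF PA] posdef_matD(2)[OF PD] by (simp add: posdef_mat_def)
  qed
qed

text \<open>
  Extend \<open>v\<close> to a basis, orthogonalise it by the Gram-Schmidt process, which keeps the first vector,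
  and normalise the result.
\<close>
lemma unitary_with_first_column:
  assumes v: "(v :: complex vec) \<in> carrier_vec n" and v0: "v \<noteq> 0\<^sub>v n"
  obtains U c where "U \<in> carrier_mat n n" "mat_adjoint U * U = 1\<^sub>m n"
    "col U 0 = c \<cdot>\<^sub>v v"
proof -
  interpret cof_vec_space n "TYPE(complex)" .
  define ws where "ws = gram_schmidt n (basis_completion v)"
  note b = basis_completion[OF v v0]
  note gs = gram_schmidt_result[OF b(2) b(4) b(5) ws_def]
  have len: "length ws = n" using gs(4) b(6) by simp
  have n: "0 < n"
  proof (rule ccontr)
    assume "\<not> 0 < n"
    then have "v = 0\<^sub>v n" using v by (intro eq_vecI) auto
    then show False using v0 by simp
  qed
  have hd: "ws ! 0 = v"
  proof -
    obtain vs where "basis_completion v = v # vs"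
      using b(6,7) n by (cases "basis_completion v") auto
    then have "hd ws = v" using gram_schmidt_hd[OF v] by (simp add: ws_def)
    then show ?thesis using len n by (cases ws) auto
  qed
  have wsc: "ws ! i \<in> carrier_vec n" if "i < n" for i
    using gs(3) len that by auto
  define c where "c i = complex_of_real (1 / sqrt (Re (ws ! i \<bullet>c ws ! i)))" for i
  define U where "U = mat n n (\<lambda>(r, i). c i * ws ! i $ r)"
  have U: "U \<in> carrier_mat n n" by (simp add: U_def)
  have colU: "col U i = c i \<cdot>\<^sub>v ws ! i" if "i < n" for i
    using wsc[OF that] that by (intro eq_vecI) (auto simp: U_def)
  have "mat_adjoint U * U = 1\<^sub>m n"
  proof (rule eq_matI)
    fix i j assume "i < dim_row (1\<^sub>m n :: complex mat)" "j < dim_col (1\<^sub>m n :: complex mat)"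
    then have ij: "i < n" "j < n" by auto
    have "(mat_adjoint U * U) $$ (i, j) = cnj (c i) * c j * (ws ! j \<bullet>c ws ! i)"
      using ij wsc[OF ij(1)] wsc[OF ij(2)] unfolding U_def
      by (auto simp: mat_adjoint_eq_mat scalar_prod_def sum_distrib_left intro!: sum.cong)
    also have "\<dots> = (if i = j then 1 else 0)"
    proof (cases "i = j")
      case False
      then show ?thesis using corthogonalD[OF gs(2), of j i] ij len by auto
    next
      case True
      define q where "q = ws ! i \<bullet>c ws ! i"
      have "q \<ge> 0" "q \<noteq> 0"
        using conjugate_square_ge_0_vec[of "ws ! i"] corthogonalD[OF gs(2), of i i] ij len
        by (auto simp: q_def)
      then have q: "Re q > 0" "q = complex_of_real (Re q)"
        by (auto simp: less_eq_complex_def complex_eq_iff)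
      have "cnj (c i) * c i = complex_of_real (1 / sqrt (Re q) * (1 / sqrt (Re q)))"
        by (simp only: c_def q_def complex_cnj_complex_of_real of_real_mult)
      also have "1 / sqrt (Re q) * (1 / sqrt (Re q)) = 1 / Re q" using q(1) by simp
      finally have "cnj (c i) * c i * q = complex_of_real (1 / Re q) * complex_of_real (Re q)"
        using q(2) by simp
      also have "\<dots> = 1" using q(1) by simp
      finally show ?thesis using True by (simp add: q_def)
    qed
    finally show "(mat_adjoint U * U) $$ (i, j) = 1\<^sub>m n $$ (i, j)" using ij by simp
  qed (auto simp: U_def mat_adjoint_eq_mat)
  then show thesis using that U colU[OF n] hd by simp
qed

lemma posdef_mat_1x1:
  "posdef_mat 1 (mat 1 1 (\<lambda>_. z)) \<longleftrightarrow> z > 0"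
proof
  assume M: "posdef_mat 1 (mat 1 1 (\<lambda>_. z))"
  have "unit_vec 1 0 \<noteq> (0\<^sub>v 1 :: complex vec)" by simp
  from posdef_matD(3)[OF M _ this]
  show "z > 0" by (simp add: scalar_prod_def)
next
  assume z: "z > 0"
  have "(mat 1 1 (\<lambda>_. z) *\<^sub>v v) \<bullet>c v > 0" if v: "v \<in> carrier_vec 1" "v \<noteq> 0\<^sub>v 1" for v
  proof -
    have "v $ 0 \<noteq> 0" using v by (auto intro!: eq_vecI)
    then have "v $ 0 * cnj (v $ 0) > 0"
      using conjugate_square_greater_0[of "v $ 0"] by simp
    then have "z * (v $ 0 * cnj (v $ 0)) > 0" using z by (simp add: less_complex_def del: complex_cnj_mult)
    then show ?thesis using v by (simp add: scalar_prod_def mult.assoc)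
  qed
  then show "posdef_mat 1 (mat 1 1 (\<lambda>_. z))"
    using z by (auto simp: posdef_mat_def mat_adjoint_eq_mat less_complex_def complex_eq_iff intro!: eq_matI)
qed

text \<open>
  Induction on the dimension. In an orthonormal basis that starts with an eigenvector, \<open>M\<close> becomes block
  diagonal: the first column is a multiple of the first unit vector, and so is the first row because
  the matrix is Hermitian. A root is taken in each of the two blocks, the second by the induction
  hypothesis, and the result is transformed back to the original basis.
\<close>
lemma posdef_sqrt_exists:
  "posdef_mat N M \<Longrightarrow> \<exists>S. posdef_mat N S \<and> S * S = M"
proof (induction N arbitrary: M)
  case 0
  then have "M * M = M" using posdef_matD(1)[OF 0] by (intro eq_matI) auto
  then show ?case using 0 by blast
next
  case (Suc N)
  let ?n = "1 + N"
  have M: "posdef_mat ?n M" using Suc.prems by simp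
  note Mc = posdef_matD(1)[OF M]
  obtain e v where v: "v \<in> carrier_vec ?n" "v \<noteq> 0\<^sub>v ?n" "M *\<^sub>v v = e \<cdot>\<^sub>v v"
    using spectrum_non_empty[OF Mc] Mc
    by (auto simp: spectrum_def eigenvalue_def eigenvector_def)
  obtain U c where U: "U \<in> carrier_mat ?n ?n" and UU: "mat_adjoint U * U = 1\<^sub>m ?n"
    and U0: "col U 0 = c \<cdot>\<^sub>v v"
    using unitary_with_first_column[OF v(1,2)] by metis
  have Ua: "mat_adjoint U \<in> carrier_mat ?n ?n" using U by simp
  have UU': "U * mat_adjoint U = 1\<^sub>m ?n"
    using mat_mult_left_right_inverse[OF Ua U UU] .
  define K where "K = mat_adjoint U * M * U"
  have Kpd: "posdef_mat ?n K"
    unfolding K_def by (rule posdef_mat_congruence[OF M U Ua UU])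
  note Kc = posdef_matD(1)[OF Kpd]
  have col_K: "col K 0 = e \<cdot>\<^sub>v unit_vec ?n 0"
  proof -
    have "col K 0 = mat_adjoint U *\<^sub>v (M *\<^sub>v col U 0)"
      unfolding K_def assoc_mult_mat[OF Ua Mc U]
      using col_mult2[OF Ua mult_carrier_mat[OF Mc U], of 0] col_mult2[OF Mc U, of 0] by simp
    also have "M *\<^sub>v col U 0 = e \<cdot>\<^sub>v col U 0"
      unfolding U0 using v Mc by (simp add: mult_mat_vec[of _ ?n ?n] smult_smult_assoc mult.commute)
    also have "mat_adjoint U *\<^sub>v (e \<cdot>\<^sub>v col U 0) = e \<cdot>\<^sub>v col (mat_adjoint U * U) 0"
      using mult_mat_vec[OF Ua, of "col U 0" e] col_carrier_vec[OF _ U, of 0]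
        col_mult2[OF Ua U, of 0] by simp
    also have "col (mat_adjoint U * U) 0 = unit_vec ?n 0" unfolding UU by simp
    finally show ?thesis .
  qed
  have K0: "K $$ (i, 0) = (if i = 0 then e else 0)" if "i < ?n" for i
  proof -
    have "K $$ (i, 0) = col K 0 $ i" using Kc that by simp
    then show ?thesis unfolding col_K using that by simp
  qed
  have K0': "K $$ (0, j) = cnj (K $$ (j, 0))" if "j < ?n" for j
  proof -
    have "mat_adjoint K $$ (0, j) = cnj (K $$ (j, 0))"
      using Kc that by (simp add: mat_adjoint_eq_mat)
    then show ?thesis using posdef_matD(2)[OF Kpd] by simp
  qed
  have "cnj e = e" using K0[of 0] K0'[of 0] by simp
  define L where "L = mat N N (\<lambda>(i, j). K $$ (Suc i, Suc j))"
  have L: "L \<in> carrier_mat N N" by (simp add: L_def)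
  have Kblock: "K = four_block_mat (mat 1 1 (\<lambda>_. e)) (0\<^sub>m 1 N) (0\<^sub>m N 1) L"
    using Kc K0 K0' \<open>cnj e = e\<close> by (intro eq_matI) (auto simp: L_def)
  have e: "e > 0" and Lpd: "posdef_mat N L"
    using Kpd posdef_mat_four_block_diag[OF _ L, of "mat 1 1 (\<lambda>_. e)" 1] posdef_mat_1x1[of e]
    unfolding Kblock by auto
  obtain T where T: "posdef_mat N T" "T * T = L" using Suc.IH[OF Lpd] by blast
  note Tc = posdef_matD(1)[OF T(1)]
  define s where "s = complex_of_real (sqrt (Re e))"
  have s: "s > 0" "s * s = e"
    using e by (auto simp: s_def less_complex_def complex_eq_iff)
  define R where "R = four_block_mat (mat 1 1 (\<lambda>_. s)) (0\<^sub>m 1 N) (0\<^sub>m N 1) T"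
  have Rpd: "posdef_mat ?n R"
    unfolding R_def using posdef_mat_four_block_diag[OF _ Tc, of "mat 1 1 (\<lambda>_. s)" 1]
      posdef_mat_1x1[of s] s T(1) by simp
  note Rc = posdef_matD(1)[OF Rpd]
  have "mat 1 1 (\<lambda>_. s) * mat 1 1 (\<lambda>_. s) = mat 1 1 (\<lambda>_. e)"
    using s by (intro eq_matI) (auto simp: scalar_prod_def)
  then have RR: "R * R = K"
    unfolding R_def Kblock using Tc T(2)
    by (subst mult_four_block_mat[of _ 1 1 _ N _ N _ _ 1 _ N]) auto
  have "posdef_mat ?n (mat_adjoint (mat_adjoint U) * R * mat_adjoint U)"
    by (rule posdef_mat_congruence[OF Rpd Ua U UU'])
  moreover have "(U * R * mat_adjoint U) * (U * R * mat_adjoint U) = M"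
  proof -
    have cancel: "mat_adjoint U * (U * X) = X" "U * (mat_adjoint U * X) = X"
      if "X \<in> carrier_mat ?n ?n" for X
      using assoc_mult_mat[OF Ua U that] assoc_mult_mat[OF U Ua that] UU UU' that by auto
    have "(U * R * mat_adjoint U) * (U * R * mat_adjoint U) = U * (R * R) * mat_adjoint U"
      using U Ua Rc cancel mult_carrier_mat[of _ ?n ?n _ ?n]
      by (simp add: assoc_mult_mat[of _ ?n ?n _ ?n _ ?n])
    also have "\<dots> = M"
      unfolding RR K_def
      using U Ua Mc cancel UU' mult_carrier_mat[of _ ?n ?n _ ?n]
      by (simp add: assoc_mult_mat[of _ ?n ?n _ ?n _ ?n])
    finally show ?thesis .
  qed
  ultimately show ?case by auto
qed

section \<open>Simultaneous permutation of rows and columns\<close>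

text \<open>
  The conjugate of \<open>M\<close> by the permutation matrix of \<open>f\<close>, written on the level of indices.
\<close>
definition perm_mat :: "nat \<Rightarrow> (nat \<Rightarrow> nat) \<Rightarrow> complex mat \<Rightarrow> complex mat" where
  "perm_mat N f M = mat N N (\<lambda>(i, j). M $$ (f i, f j))"

lemma perm_mat_mult:
  assumes f: "bij_betw f {..<N} {..<N}" and "A \<in> carrier_mat N N" "B \<in> carrier_mat N N"
  shows "perm_mat N f (A * B) = perm_mat N f A * perm_mat N f B"
proof (rule eq_matI)
  fix i j assume "i < dim_row (perm_mat N f A * perm_mat N f B)"
    "j < dim_col (perm_mat N f A * perm_mat N f B)"
  then have ij: "i < N" "j < N" by (auto simp: perm_mat_def)
  then have fij: "f i < N" "f j < N" using f by (auto simp: bij_betw_def)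
  have "(A * B) $$ (f i, f j) = (\<Sum>k<N. A $$ (f i, k) * B $$ (k, f j))"
    using assms fij by (auto simp: scalar_prod_def lessThan_atLeast0)
  also have "\<dots> = (\<Sum>k<N. A $$ (f i, f k) * B $$ (f k, f j))"
    by (rule sum.reindex_bij_betw[OF f, symmetric])
  finally show "perm_mat N f (A * B) $$ (i, j) = (perm_mat N f A * perm_mat N f B) $$ (i, j)"
    using ij by (auto simp: perm_mat_def scalar_prod_def lessThan_atLeast0)
qed (auto simp: perm_mat_def)

lemma perm_mat_one:
  assumes f: "bij_betw f {..<N} {..<N}"
  shows "perm_mat N f (1\<^sub>m N) = 1\<^sub>m N"
proof (rule eq_matI)
  fix i j assume "i < dim_row (1\<^sub>m N :: complex mat)" "j < dim_col (1\<^sub>m N :: complex mat)"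
  then have ij: "i < N" "j < N" by auto
  then have "f i < N" "f j < N" "f i = f j \<longleftrightarrow> i = j"
    using f by (auto simp: bij_betw_def inj_on_def)
  then show "perm_mat N f (1\<^sub>m N) $$ (i, j) = 1\<^sub>m N $$ (i, j)"
    using ij by (simp add: perm_mat_def)
qed (auto simp: perm_mat_def)

text \<open>
  A permutation is a congruence by a permutation matrix \<open>U\<close>, whose inverse is its adjoint.
\<close>
lemma posdef_perm_mat:
  assumes f: "bij_betw f {..<N} {..<N}" and M: "posdef_mat N M"
  shows "posdef_mat N (perm_mat N f M)"
proof -
  define U where "U = mat N N (\<lambda>(k, i). if k = f i then 1 else 0 :: complex)"
  note Mc = posdef_matD(1)[OF M]
  have U: "U \<in> carrier_mat N N" by (simp add: U_def)
  have U_entry: "U $$ (k, i) = (if k = f i then 1 else 0)" if "k < N" "i < N" for k i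
    using that by (simp add: U_def)
  have f_less: "f i < N" if "i < N" for i using f that by (auto simp: bij_betw_def)
  have cong: "mat_adjoint U * A * U = perm_mat N f A" if A: "A \<in> carrier_mat N N" for A
  proof (rule eq_matI)
    fix i j assume "i < dim_row (perm_mat N f A)" "j < dim_col (perm_mat N f A)"
    then have ij: "i < N" "j < N" by (auto simp: perm_mat_def)
    have row: "(mat_adjoint U * A) $$ (i, k) = A $$ (f i, k)" if "k < N" for k
    proof -
      have "(mat_adjoint U * A) $$ (i, k) = (\<Sum>l<N. cnj (U $$ (l, i)) * A $$ (l, k))"
        using U A ij that unfolding lessThan_atLeast0
        by (auto simp: mat_adjoint_eq_mat scalar_prod_def intro!: sum.cong)
      also have "\<dots> = (\<Sum>l<N. if l = f i then A $$ (l, k) else 0)"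
        using ij by (intro sum.cong) (auto simp: U_entry)
      finally show ?thesis using f_less[OF ij(1)] by simp
    qed
    have "(mat_adjoint U * A * U) $$ (i, j)
        = (\<Sum>k<N. (mat_adjoint U * A) $$ (i, k) * U $$ (k, j))"
      by (rule index_mult_mat_sum[OF mult_carrier_mat[OF mat_adjoint_carrier[OF U] A] U ij])
    also have "\<dots> = (\<Sum>k<N. if k = f j then A $$ (f i, k) else 0)"
      using ij by (intro sum.cong) (simp_all add: row U_entry del: index_mult_mat(1))
    finally show "(mat_adjoint U * A * U) $$ (i, j) = perm_mat N f A $$ (i, j)"
      using f_less[OF ij(2)] ij by (simp add: perm_mat_def del: index_mult_mat(1))
  qed (use U A in \<open>auto simp: perm_mat_def mat_adjoint_eq_mat\<close>)
  have "mat_adjoint U * U = 1\<^sub>m N"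
    using cong[of "1\<^sub>m N"] perm_mat_one[OF f] mat_adjoint_carrier[OF U] by simp
  then have "posdef_mat N (mat_adjoint U * M * U)"
    by (rule posdef_mat_congruence[OF M U mat_adjoint_carrier[OF U]])
  then show ?thesis using cong[OF Mc] by simp
qed

section \<open>Unfolding tensors\<close>

lemma tensors_nth:
  "A \<in> tensors m n p \<Longrightarrow> k < p \<Longrightarrow> A ! k \<in> carrier_mat m n"
  by (auto simp: tensors_def)

lemma tensors_dims:
  assumes "A \<in> tensors m n p" "p > 0"
  shows "length A = p" "slice_rows A = m" "slice_cols A = n"
  using assms tensors_nth[of A m n p 0] by (auto simp: tensors_def slice_rows_def slice_cols_def)

lemma bcirc_eq_mat:
  assumes "A \<in> tensors m n p" "p > 0"
  shows "bcirc A = mat (m * p) (n * p)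
    (\<lambda>(r, c). (A ! ((r div m + p - c div n) mod p)) $$ (r mod m, c mod n))"
  using tensors_dims[OF assms] by (simp add: bcirc_def Let_def)

lemma tunfold_eq_mat:
  assumes "A \<in> tensors m n p" "p > 0"
  shows "tunfold A = mat (m * p) n (\<lambda>(r, c). (A ! (r div m)) $$ (r mod m, c))"
  using tensors_dims[OF assms] by (simp add: tunfold_def Let_def)

lemma bcirc_carrier [simp]:
  "A \<in> tensors m n p \<Longrightarrow> p > 0 \<Longrightarrow> bcirc A \<in> carrier_mat (m * p) (n * p)"
  by (simp add: bcirc_eq_mat)

lemma tunfold_carrier [simp]:
  "A \<in> tensors m n p \<Longrightarrow> p > 0 \<Longrightarrow> tunfold A \<in> carrier_mat (m * p) n"
  by (simp add: tunfold_eq_mat)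

lemma tfold_eq:
  assumes "M \<in> carrier_mat (m * p) n" "p > 0"
  shows "tfold p M = map (\<lambda>k. mat m n (\<lambda>(i, j). M $$ (k * m + i, j))) [0..<p]"
  using assms by (simp add: tfold_def Let_def)

lemma tfold_tensors:
  assumes "M \<in> carrier_mat (m * p) n" "p > 0"
  shows "tfold p M \<in> tensors m n p"
  using assms by (auto simp: tfold_eq tensors_def)

lemma block_index_less: "k < p \<Longrightarrow> i < m \<Longrightarrow> k * m + i < m * p" for k p i m :: nat
proof -
  assume "k < p" "i < m"
  then have "k * m + i < Suc k * m" by simp
  also have "\<dots> \<le> p * m" using \<open>k < p\<close> by (intro mult_le_mono1) simp
  finally show ?thesis by (simp add: mult.commute)
qed

lemma block_index_div: "r < m * p \<Longrightarrow> r div m < p" for r m p :: nat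
  by (simp add: less_mult_imp_div_less mult.commute)

lemma block_index_mod: "r < m * p \<Longrightarrow> r mod m < m" for r m p :: nat
  by (cases m) auto

lemma tunfold_tfold:
  assumes "M \<in> carrier_mat (m * p) n" "p > 0"
  shows "tunfold (tfold p M) = M"
  unfolding tunfold_eq_mat[OF tfold_tensors[OF assms] assms(2)] unfolding tfold_eq[OF assms]
  using assms block_index_div[of _ m p] block_index_mod[of _ m p]
  by (intro eq_matI) auto

lemma tunfold_index:
  assumes "A \<in> tensors m n p" "k < p" "i < m" "j < n"
  shows "tunfold A $$ (k * m + i, j) = (A ! k) $$ (i, j)"
  using assms block_index_less[of k p i m] by (simp add: tunfold_eq_mat)

lemma tfold_tunfold:
  assumes A: "A \<in> tensors m n p" and p: "p > 0"
  shows "tfold p (tunfold A) = A"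
proof (rule nth_equalityI)
  show "length (tfold p (tunfold A)) = length A"
    using tfold_eq[OF tunfold_carrier[OF assms] p] tensors_dims[OF assms] by simp
next
  fix k assume "k < length (tfold p (tunfold A))"
  then have k: "k < p" using tfold_eq[OF tunfold_carrier[OF assms] p] by simp
  then show "tfold p (tunfold A) ! k = A ! k"
    using tensors_nth[OF A k]
    by (intro eq_matI) (auto simp: tfold_eq[OF tunfold_carrier[OF assms] p] tunfold_index[OF A k])
qed

lemma tunfold_inj:
  assumes "A \<in> tensors m n p" "B \<in> tensors m n p" "p > 0" "tunfold A = tunfold B"
  shows "A = B"
  using assms tfold_tunfold by metis

lemma tprod_tensors:
  assumes "A \<in> tensors m n p" "B \<in> tensors n k p" "p > 0"
  shows "A *\<^sub>T B \<in> tensors m k p"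
  unfolding tprod_def tensors_dims(1)[OF assms(1,3)]
  by (rule tfold_tensors[OF mult_carrier_mat[OF bcirc_carrier tunfold_carrier]]; fact assms)

lemma tunfold_tprod:
  assumes "A \<in> tensors m n p" "B \<in> tensors n k p" "p > 0"
  shows "tunfold (A *\<^sub>T B) = bcirc A * tunfold B"
  unfolding tprod_def tensors_dims(1)[OF assms(1,3)]
  by (rule tunfold_tfold[OF mult_carrier_mat[OF bcirc_carrier tunfold_carrier]]; fact assms)

section \<open>Block circulant matrices\<close>

text \<open>
  Index \<open>k * n + i\<close> belongs to position \<open>i\<close> of block \<open>k\<close>. The map moves each of the \<open>p\<close> blocks to the
  next one, the last to the first, and keeps the position within the block.
\<close>
definition block_shift :: "nat \<Rightarrow> nat \<Rightarrow> nat \<Rightarrow> nat" where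
  "block_shift n p i = (i + n) mod (n * p)"

lemma block_shift_less: "0 < n \<Longrightarrow> 0 < p \<Longrightarrow> block_shift n p i < n * p"
  by (simp add: block_shift_def)

lemma block_shift_div_mod:
  assumes "0 < n" "0 < p"
  shows "block_shift n p i div n = Suc (i div n) mod p" "block_shift n p i mod n = i mod n"
  using assms
  by (auto simp: block_shift_def mod_mult2_eq add.commute)

lemma inj_on_block_shift:
  assumes "0 < n" "0 < p"
  shows "inj_on (block_shift n p) {..<n * p}"
proof (rule inj_onI)
  fix i j assume "i \<in> {..<n * p}" "j \<in> {..<n * p}" and eq: "block_shift n p i = block_shift n p j"
  then have less: "i div n < p" "j div n < p" using block_index_div by auto
  have "Suc (i div n) mod p = Suc (j div n) mod p" and mod: "i mod n = j mod n"
    using eq block_shift_div_mod[OF assms] by metis+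
  then have "i div n = j div n" using less by (auto simp: mod_Suc split: if_splits)
  then show "i = j" using mod by (metis div_mult_mod_eq)
qed

lemma bij_betw_block_shift:
  assumes "0 < n" "0 < p"
  shows "bij_betw (block_shift n p) {..<n * p} {..<n * p}"
proof -
  have "block_shift n p ` {..<n * p} = {..<n * p}"
    using block_shift_less[OF assms]
    by (intro endo_inj_surj inj_on_block_shift assms) auto
  then show ?thesis by (simp add: bij_betw_def inj_on_block_shift[OF assms])
qed

text \<open>
  The description as fixed points, rather than by a formula for the entries, makes closure under
  products, inverses and square roots immediate.
\<close>
definition block_circulant :: "nat \<Rightarrow> nat \<Rightarrow> complex mat \<Rightarrow> bool" where
  "block_circulant n p M \<longleftrightarrow>
     M \<in> carrier_mat (n * p) (n * p) \<and> perm_mat (n * p) (block_shift n p) M = M"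

lemma block_circulant_shift:
  assumes "block_circulant n p M" "r < n * p" "c < n * p"
  shows "M $$ (block_shift n p r, block_shift n p c) = M $$ (r, c)"
proof -
  have "perm_mat (n * p) (block_shift n p) M $$ (r, c) = M $$ (r, c)"
    using assms by (simp add: block_circulant_def)
  then show ?thesis using assms by (simp add: perm_mat_def)
qed

text \<open>
  By shift invariance the first block column determines the second one, this the third one, and so on.
\<close>
lemma block_circulant_eqI:
  assumes np: "0 < n" "0 < p"
    and M: "block_circulant n p M" and M': "block_circulant n p M'"
    and first: "\<And>r c. r < n * p \<Longrightarrow> c < n \<Longrightarrow> M $$ (r, c) = M' $$ (r, c)"
  shows "M = M'"
proof -
  have eq: "M $$ (r, l * n + c) = M' $$ (r, l * n + c)" if "l < p" "r < n * p" "c < n" for l r c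
    using that
  proof (induction l arbitrary: r)
    case 0
    then show ?case using first by simp
  next
    case (Suc l)
    obtain r' where r': "r' < n * p" "r = block_shift n p r'"
      using bij_betw_block_shift[OF np] Suc.prems(2) by (auto simp: bij_betw_def image_iff)
    have lt: "l * n + c < n * p" "Suc l * n + c < n * p"
      using Suc.prems block_index_less[of l p c n] block_index_less[of "Suc l" p c n] by auto
    then have shift: "Suc l * n + c = block_shift n p (l * n + c)"
      by (simp add: block_shift_def add_ac)
    show ?case
      unfolding shift r'(2)
      using block_circulant_shift[OF M r'(1) lt(1)] block_circulant_shift[OF M' r'(1) lt(1)]
        Suc.IH[of r'] Suc.prems r'(1) by simp
  qed
  show ?thesis
  proof (rule eq_matI)
    fix r c assume "r < dim_row M'" "c < dim_col M'"
    then have rc: "r < n * p" "c < n * p" using M' by (auto simp: block_circulant_def)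
    then show "M $$ (r, c) = M' $$ (r, c)"
      using eq[of "c div n" r "c mod n"] block_index_div[of c n p] np by simp
  qed (use M M' in \<open>auto simp: block_circulant_def\<close>)
qed

lemma block_circulant_mult:
  assumes "0 < n" "0 < p" "block_circulant n p A" "block_circulant n p B"
  shows "block_circulant n p (A * B)"
  using assms perm_mat_mult[OF bij_betw_block_shift[OF assms(1,2)], of A B]
  by (auto simp: block_circulant_def)

text \<open>
  The index \<open>a - b\<close> modulo \<open>p\<close> of the slice in block \<open>(a, b)\<close> does not change if both block indices
  advance cyclically; the summand \<open>p\<close> compensates for truncated subtraction.
\<close>
lemma circ_diff_Suc:
  assumes "a < p" "b < p"
  shows "(Suc a mod p + p - Suc b mod p) mod p = (a + p - b) mod (p :: nat)"
proof (cases "Suc a = p"; cases "Suc b = p")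
  assume "Suc a = p" "Suc b \<noteq> p"
  have "(a + p - b) mod p = (a - b + p) mod p" using assms \<open>Suc a = p\<close> by simp
  also have "\<dots> = a - b" using assms by simp
  finally show ?thesis using assms \<open>Suc a = p\<close> \<open>Suc b \<noteq> p\<close> by simp
qed (use assms in \<open>auto simp: mod_if\<close>)

section \<open>The embedding of tensors as block circulant matrices\<close>

lemma block_circulant_bcirc:
  assumes np: "0 < n" "0 < p" and A: "A \<in> tensors n n p"
  shows "block_circulant n p (bcirc A)"
  unfolding block_circulant_def
proof
  show "bcirc A \<in> carrier_mat (n * p) (n * p)" using A np by simp
  show "perm_mat (n * p) (block_shift n p) (bcirc A) = bcirc A"
    using A np block_shift_less[OF np] block_index_div[of _ n p]
    by (intro eq_matI)
       (auto simp: perm_mat_def bcirc_eq_mat block_shift_div_mod circ_diff_Suc)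
qed

lemma bcirc_first_block_column:
  assumes "0 < p" "A \<in> tensors n n p" "r < n * p" "c < n"
  shows "bcirc A $$ (r, c) = tunfold A $$ (r, c)"
proof -
  have "c < n * p" using block_index_less[of 0 p c n] assms by simp
  then show ?thesis
    using assms block_index_div[of r n p] by (simp add: bcirc_eq_mat tunfold_eq_mat)
qed

lemma bcirc_eqI:
  assumes np: "0 < n" "0 < p" and A: "A \<in> tensors n n p" and M: "block_circulant n p M"
    and first: "\<And>r c. r < n * p \<Longrightarrow> c < n \<Longrightarrow> tunfold A $$ (r, c) = M $$ (r, c)"
  shows "bcirc A = M"
  using first bcirc_first_block_column[OF np(2) A]
  by (intro block_circulant_eqI[OF np block_circulant_bcirc[OF np A] M]) simp

text \<open>
  Both sides are block circulant, so only the first block columns need to be compared. There, the matrix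
  of a tensor is its unfolding, and the claim is the definition of the T-product.
\<close>
lemma bcirc_tprod:
  assumes np: "0 < n" "0 < p" and A: "A \<in> tensors n n p" and B: "B \<in> tensors n n p"
  shows "bcirc (A *\<^sub>T B) = bcirc A * bcirc B"
proof (rule bcirc_eqI[OF np tprod_tensors[OF A B np(2)]])
  show "block_circulant n p (bcirc A * bcirc B)"
    by (intro block_circulant_mult block_circulant_bcirc np A B)
  fix r c assume r: "r < n * p" and c: "c < n"
  have c': "c < n * p" using block_index_less[of 0 p c n] c np by simp
  have "col (bcirc B) c = col (tunfold B) c"
    using B np c c' bcirc_first_block_column[OF np(2) B _ c]
      carrier_matD[OF bcirc_carrier[OF B np(2)]] carrier_matD[OF tunfold_carrier[OF B np(2)]]
    by (intro eq_vecI) auto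
  then show "tunfold (A *\<^sub>T B) $$ (r, c) = (bcirc A * bcirc B) $$ (r, c)"
    unfolding tunfold_tprod[OF A B np(2)]
    using r c c' carrier_matD[OF bcirc_carrier[OF B np(2)]]
      carrier_matD[OF bcirc_carrier[OF A np(2)]] carrier_matD[OF tunfold_carrier[OF B np(2)]]
    by simp
qed

lemma bcirc_inj:
  assumes np: "0 < n" "0 < p" and A: "A \<in> tensors n n p" and B: "B \<in> tensors n n p"
    and eq: "bcirc A = bcirc B"
  shows "A = B"
proof (rule tunfold_inj[OF A B np(2)], rule eq_matI)
  fix r c assume "r < dim_row (tunfold B)" "c < dim_col (tunfold B)"
  then show "tunfold A $$ (r, c) = tunfold B $$ (r, c)"
    using eq bcirc_first_block_column[OF np(2) A] bcirc_first_block_column[OF np(2) B]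
      carrier_matD[OF tunfold_carrier[OF B np(2)]] by simp
qed (use A B np in \<open>auto simp: tunfold_eq_mat\<close>)

text \<open>
  The slices can be read off the first block column.
\<close>
lemma block_circulant_obtain_tensor:
  assumes np: "0 < n" "0 < p" and M: "block_circulant n p M"
  obtains A where "A \<in> tensors n n p" "bcirc A = M"
proof
  define F where "F = mat (n * p) n (\<lambda>(r, c). M $$ (r, c))"
  have F: "F \<in> carrier_mat (n * p) n" by (simp add: F_def)
  show T: "tfold p F \<in> tensors n n p" by (rule tfold_tensors[OF F np(2)])
  show "bcirc (tfold p F) = M"
    by (rule bcirc_eqI[OF np T M]) (simp add: tunfold_tfold[OF F np(2)], simp add: F_def)
qed

lemma tid_tensors: "tid n p \<in> tensors n n p"
  by (auto simp: tid_def tensors_def)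

lemma tid_nth: "k < p \<Longrightarrow> tid n p ! k = (if k = 0 then 1\<^sub>m n else 0\<^sub>m n n)"
  by (simp add: tid_def)

lemma bcirc_tid:
  assumes np: "0 < n" "0 < p"
  shows "bcirc (tid n p) = 1\<^sub>m (n * p)"
proof (rule bcirc_eqI[OF np tid_tensors])
  show "block_circulant n p (1\<^sub>m (n * p))"
    using perm_mat_one[OF bij_betw_block_shift[OF np]] by (simp add: block_circulant_def)
  fix r c assume r: "r < n * p" and c: "c < n"
  have c': "c < n * p" using block_index_less[of 0 p c n] c np by simp
  have "r = c \<longleftrightarrow> r div n = 0 \<and> r mod n = c"
    using c np by (auto simp: div_eq_0_iff)
  then show "tunfold (tid n p) $$ (r, c) = 1\<^sub>m (n * p) $$ (r, c)"
    using r c c' block_index_div[OF r] np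
    by (auto simp: tunfold_eq_mat[OF tid_tensors np(2)] tid_nth)
qed

lemma tadjoint_tensors:
  assumes "A \<in> tensors m n p"
  shows "tadjoint A \<in> tensors n m p"
proof -
  have "mat_adjoint (A ! ((p - k) mod p)) \<in> carrier_mat n m" if "k < p" for k
    by (intro mat_adjoint_carrier tensors_nth[OF assms]) (use that in simp)
  moreover have "length A = p" using assms by (simp add: tensors_def)
  ultimately show ?thesis by (auto simp: tadjoint_def tensors_def)
qed

lemma tadjoint_nth:
  "k < length A \<Longrightarrow> tadjoint A ! k = mat_adjoint (A ! ((length A - k) mod length A))"
  by (simp add: tadjoint_def)

text \<open>
  Transposition exchanges the block indices \<open>a\<close> and \<open>b\<close>; this negates the slice index modulo \<open>p\<close>, which is
  the reversal of slices in the T-conjugate transpose.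
\<close>
lemma circ_diff_neg:
  assumes "a < p" "b < p"
  shows "(p - (a + p - b) mod p) mod p = (b + p - a) mod (p :: nat)"
  using assms by (cases a b rule: linorder_cases) (auto simp: mod_if)

lemma bcirc_tadjoint:
  assumes A: "A \<in> tensors m n p" and p: "0 < p"
  shows "bcirc (tadjoint A) = mat_adjoint (bcirc A)"
proof (rule eq_matI)
  note T = tadjoint_tensors[OF A]
  fix r c assume "r < dim_row (mat_adjoint (bcirc A))" "c < dim_col (mat_adjoint (bcirc A))"
  then have rc: "r < n * p" "c < m * p"
    using carrier_matD[OF bcirc_carrier[OF A p]] by (auto simp: mat_adjoint_eq_mat)
  define k where "k = (r div n + p - c div m) mod p"
  have k: "k < p" using p by (simp add: k_def)
  have nk: "(p - k) mod p = (c div m + p - r div n) mod p"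
    unfolding k_def by (rule circ_diff_neg) (use rc block_index_div in auto)
  have S: "A ! ((p - k) mod p) \<in> carrier_mat m n"
    by (rule tensors_nth[OF A]) (use p in simp)
  have "bcirc (tadjoint A) $$ (r, c) = cnj ((A ! ((p - k) mod p)) $$ (c mod m, r mod n))"
    using rc k S tensors_dims(1)[OF A p] block_index_mod[OF rc(1)] block_index_mod[OF rc(2)]
    by (simp add: bcirc_eq_mat[OF T p] k_def[symmetric] tadjoint_nth mat_adjoint_eq_mat)
  also have "\<dots> = mat_adjoint (bcirc A) $$ (r, c)"
    using rc by (simp add: bcirc_eq_mat[OF A p] mat_adjoint_eq_mat nk)
  finally show "bcirc (tadjoint A) $$ (r, c) = mat_adjoint (bcirc A) $$ (r, c)" .
qed (use A tadjoint_tensors[OF A] p in \<open>auto simp: bcirc_eq_mat mat_adjoint_eq_mat\<close>)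

section \<open>T-positive definite tensors\<close>

lemma tinner_tunfold:
  assumes X: "X \<in> tensors n 1 p" and Y: "Y \<in> tensors n 1 p" and p: "0 < p"
  shows "tinner X Y = col (tunfold Y) 0 \<bullet>c col (tunfold X) 0"
proof -
  define f where "f r = cnj (tunfold X $$ (r, 0)) * tunfold Y $$ (r, 0)" for r
  have "tinner X Y = (\<Sum>i<n. \<Sum>k<p. cnj ((X ! k) $$ (i, 0)) * (Y ! k) $$ (i, 0))"
    using tensors_dims[OF X p] by (simp add: tinner_def)
  also have "\<dots> = (\<Sum>k<p. \<Sum>i<n. f (k * n + i))"
    by (subst sum.swap)
       (auto intro!: sum.cong simp: f_def tunfold_index[OF X] tunfold_index[OF Y])
  also have "\<dots> = (\<Sum>k<p. sum f {k * n..<k * n + n})"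
  proof (rule sum.cong)
    fix k
    show "(\<Sum>i<n. f (k * n + i)) = sum f {k * n..<k * n + n}"
      using sum.shift_bounds_nat_ivl[of f 0 "k * n" n]
      by (simp add: lessThan_atLeast0 add.commute[of _ "k * n"])
  qed simp
  also have "\<dots> = (\<Sum>r<p * n. f r)" by (rule sum.nat_group)
  also have "\<dots> = col (tunfold Y) 0 \<bullet>c col (tunfold X) 0"
    using tunfold_carrier[OF X p] tunfold_carrier[OF Y p]
    by (auto simp: f_def scalar_prod_def lessThan_atLeast0 mult.commute intro!: sum.cong)
  finally show ?thesis .
qed

lemma tzero_nth: "k < p \<Longrightarrow> tzero m n p ! k = 0\<^sub>m m n"
  by (simp add: tzero_def)

text \<open>
  Tensors of size \<open>n \<times> 1 \<times> p\<close> correspond to vectors of length \<open>n * p\<close> by unfolding. Under this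
  correspondence the tensor form \<open>\<langle>X, A * X\<rangle>\<close> is the quadratic form of \<open>bcirc A\<close>.
\<close>
lemma t_posdef_iff_bcirc:
  assumes np: "0 < n" "0 < p"
  shows "A \<in> t_posdef n p \<longleftrightarrow> A \<in> tensors n n p \<and> posdef_mat (n * p) (bcirc A)"
proof (cases "A \<in> tensors n n p")
  case False
  then show ?thesis by (simp add: t_posdef_def t_hermitian_def)
next
  case A: True
  note Ac = bcirc_carrier[OF A np(2)]
  have herm: "tadjoint A = A \<longleftrightarrow> mat_adjoint (bcirc A) = bcirc A"
    using bcirc_tadjoint[OF A np(2)] bcirc_inj[OF np tadjoint_tensors[OF A] A] by metis
  have Z: "tzero n 1 p \<in> tensors n 1 p" by (auto simp: tzero_def tensors_def)
  have form: "tinner X (A *\<^sub>T X) = (bcirc A *\<^sub>v col (tunfold X) 0) \<bullet>c col (tunfold X) 0"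
    if X: "X \<in> tensors n 1 p" for X
    using tinner_tunfold[OF X tprod_tensors[OF A X np(2)] np(2)] tunfold_tprod[OF A X np(2)]
      col_mult2[OF Ac tunfold_carrier[OF X np(2)], of 0] by simp
  have zero: "X = tzero n 1 p \<longleftrightarrow> col (tunfold X) 0 = 0\<^sub>v (n * p)"
    if X: "X \<in> tensors n 1 p" for X
  proof -
    have tz: "tunfold (tzero n 1 p) = 0\<^sub>m (n * p) 1"
      using block_index_div[of _ n p] block_index_mod[of _ n p]
      by (intro eq_matI) (auto simp: tunfold_eq_mat[OF Z np(2)] tzero_nth simp del: One_nat_def)
    have "tunfold X = 0\<^sub>m (n * p) 1" if c: "col (tunfold X) 0 = 0\<^sub>v (n * p)"
    proof (rule eq_matI)
      fix r j assume "r < dim_row (0\<^sub>m (n * p) 1 :: complex mat)"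
        "j < dim_col (0\<^sub>m (n * p) 1 :: complex mat)"
      then have rj: "r < n * p" "j = 0" by auto
      then have "tunfold X $$ (r, j) = col (tunfold X) 0 $ r"
        using carrier_matD[OF tunfold_carrier[OF X np(2)]] by simp
      then show "tunfold X $$ (r, j) = 0\<^sub>m (n * p) 1 $$ (r, j)" using c rj by simp
    qed (use carrier_matD[OF tunfold_carrier[OF X np(2)]] in auto)
    then show ?thesis using tz tunfold_inj[OF X Z np(2)] by auto
  qed
  have vecs: "\<exists>X \<in> tensors n 1 p. col (tunfold X) 0 = v" if v: "v \<in> carrier_vec (n * p)" for v
  proof
    define F where "F = mat (n * p) 1 (\<lambda>(r, j). v $ r)"
    have F: "F \<in> carrier_mat (n * p) 1" by (simp add: F_def)
    show "tfold p F \<in> tensors n 1 p" by (rule tfold_tensors[OF F np(2)])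
    show "col (tunfold (tfold p F)) 0 = v"
      unfolding tunfold_tfold[OF F np(2)] using v by (intro eq_vecI) (auto simp: F_def)
  qed
  have "(\<forall>X \<in> tensors n 1 p. X \<noteq> tzero n 1 p \<longrightarrow> tinner X (A *\<^sub>T X) > 0)
      \<longleftrightarrow> (\<forall>v \<in> carrier_vec (n * p). v \<noteq> 0\<^sub>v (n * p) \<longrightarrow> (bcirc A *\<^sub>v v) \<bullet>c v > 0)"
  proof
    assume L: "\<forall>X \<in> tensors n 1 p. X \<noteq> tzero n 1 p \<longrightarrow> tinner X (A *\<^sub>T X) > 0"
    show "\<forall>v \<in> carrier_vec (n * p). v \<noteq> 0\<^sub>v (n * p) \<longrightarrow> (bcirc A *\<^sub>v v) \<bullet>c v > 0"
      using L vecs form zero by metis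
  next
    assume R: "\<forall>v \<in> carrier_vec (n * p). v \<noteq> 0\<^sub>v (n * p) \<longrightarrow> (bcirc A *\<^sub>v v) \<bullet>c v > 0"
    have "col (tunfold X) 0 \<in> carrier_vec (n * p)" if "X \<in> tensors n 1 p" for X
      using col_carrier_vec[OF _ tunfold_carrier[OF that np(2)], of 0] by simp
    then show "\<forall>X \<in> tensors n 1 p. X \<noteq> tzero n 1 p \<longrightarrow> tinner X (A *\<^sub>T X) > 0"
      using R form zero by metis
  qed
  then show ?thesis
    using A Ac herm by (simp add: t_posdef_def t_hermitian_def posdef_mat_def)
qed

lemma t_posdef_obtain:
  assumes np: "0 < n" "0 < p" and M: "posdef_mat (n * p) M"
    and inv: "perm_mat (n * p) (block_shift n p) M = M"
  obtains A where "A \<in> t_posdef n p" "bcirc A = M"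
proof -
  have "block_circulant n p M"
    using inv posdef_matD(1)[OF M] by (simp add: block_circulant_def)
  then obtain A where "A \<in> tensors n n p" "bcirc A = M"
    using block_circulant_obtain_tensor[OF np] by blast
  then show thesis using that M t_posdef_iff_bcirc[OF np] by blast
qed

lemma tinv_eqI:
  assumes np: "0 < n" "0 < p" and A: "A \<in> tensors n n p" and B: "B \<in> tensors n n p"
    and AB: "bcirc A * bcirc B = 1\<^sub>m (n * p)" and BA: "bcirc B * bcirc A = 1\<^sub>m (n * p)"
  shows "tinv A = B"
proof -
  have inv_iff: "X *\<^sub>T Y = tid n p \<longleftrightarrow> bcirc X * bcirc Y = 1\<^sub>m (n * p)"
    if "X \<in> tensors n n p" "Y \<in> tensors n n p" for X Y
    using that bcirc_tprod[OF np that] bcirc_tid[OF np] tid_tensors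
      bcirc_inj[OF np tprod_tensors[OF that np(2)] tid_tensors] by metis
  show ?thesis
    unfolding tinv_def Let_def tensors_dims[OF A np(2)]
  proof (rule the_equality)
    show "B \<in> tensors n n p \<and> A *\<^sub>T B = tid n p \<and> B *\<^sub>T A = tid n p"
      using A B AB BA by (simp add: inv_iff)
    fix C assume C: "C \<in> tensors n n p \<and> A *\<^sub>T C = tid n p \<and> C *\<^sub>T A = tid n p"
    then have CA: "bcirc C * bcirc A = 1\<^sub>m (n * p)" using A inv_iff[of C A] by blast
    have c: "bcirc A \<in> carrier_mat (n * p) (n * p)" "bcirc B \<in> carrier_mat (n * p) (n * p)"
      "bcirc C \<in> carrier_mat (n * p) (n * p)"
      using A B C np by auto
    have "bcirc C = bcirc C * (bcirc A * bcirc B)" using c AB by simp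
    also have "\<dots> = bcirc B" using assoc_mult_mat[OF c(3,1,2)] c CA by simp
    finally show "C = B" using bcirc_inj[OF np _ B] C by blast
  qed
qed

text \<open>
  If \<open>W\<close> is the inverse of \<open>bcirc A\<close>, then so is its image under the block shift, because the shift is an
  automorphism that fixes \<open>bcirc A\<close>. Hence \<open>W\<close> is shift invariant, that is, the matrix of a tensor.
\<close>
lemma t_posdef_tinv:
  assumes np: "0 < n" "0 < p" and A: "A \<in> t_posdef n p"
  shows "tinv A \<in> t_posdef n p"
    and "bcirc A * bcirc (tinv A) = 1\<^sub>m (n * p)"
    and "bcirc (tinv A) * bcirc A = 1\<^sub>m (n * p)"
proof -
  let ?N = "n * p" and ?P = "perm_mat (n * p) (block_shift n p)"
  have At: "A \<in> tensors n n p" and Apd: "posdef_mat ?N (bcirc A)"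
    using A t_posdef_iff_bcirc[OF np] by auto
  note Ac = posdef_matD(1)[OF Apd]
  obtain W where W: "posdef_mat ?N W" "W * bcirc A = 1\<^sub>m ?N" "bcirc A * W = 1\<^sub>m ?N"
    using posdef_mat_inverse[OF Apd] by blast
  note Wc = posdef_matD(1)[OF W(1)]
  have PWc: "?P W \<in> carrier_mat ?N ?N" by (simp add: perm_mat_def)
  have "?P W * bcirc A = ?P (W * bcirc A)"
    using perm_mat_mult[OF bij_betw_block_shift[OF np] Wc Ac] block_circulant_bcirc[OF np At]
    by (simp add: block_circulant_def)
  then have "?P W * bcirc A = 1\<^sub>m ?N"
    using W(2) perm_mat_one[OF bij_betw_block_shift[OF np]] by simp
  then have "?P W = W"
    using assoc_mult_mat[OF PWc Ac Wc] W(3) PWc Wc by simp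
  then obtain B where B: "B \<in> t_posdef n p" "bcirc B = W"
    using t_posdef_obtain[OF np W(1)] by blast
  then have "tinv A = B"
    using tinv_eqI[OF np At, of B] W t_posdef_iff_bcirc[OF np] by auto
  then show "tinv A \<in> t_posdef n p" "bcirc A * bcirc (tinv A) = 1\<^sub>m ?N"
    "bcirc (tinv A) * bcirc A = 1\<^sub>m ?N"
    using B W by auto
qed

lemma tsqrt_eqI:
  assumes np: "0 < n" "0 < p" and A: "A \<in> tensors n n p"
    and S: "S \<in> t_posdef n p" and SS: "S *\<^sub>T S = A"
  shows "tsqrt A = S"
  unfolding tsqrt_def tensors_dims[OF A np(2)]
proof (rule the_equality)
  show "S \<in> t_posdef n p \<and> S *\<^sub>T S = A" using S SS by simp
  fix T assume T: "T \<in> t_posdef n p \<and> T *\<^sub>T T = A"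
  then have Tt: "T \<in> tensors n n p" "posdef_mat (n * p) (bcirc T)"
    and St: "S \<in> tensors n n p" "posdef_mat (n * p) (bcirc S)"
    using S t_posdef_iff_bcirc[OF np] by auto
  have "bcirc T * bcirc T = bcirc S * bcirc S"
    using bcirc_tprod[OF np Tt(1) Tt(1)] bcirc_tprod[OF np St(1) St(1)] T SS by simp
  then have "bcirc T = bcirc S" by (rule posdef_sqrt_unique[OF Tt(2) St(2)])
  then show "T = S" by (rule bcirc_inj[OF np Tt(1) St(1)])
qed

text \<open>
  As for inverses, with the uniqueness of positive definite square roots in place of the uniqueness of
  inverses.
\<close>
lemma t_posdef_tsqrt:
  assumes np: "0 < n" "0 < p" and A: "A \<in> t_posdef n p"
  shows "tsqrt A \<in> t_posdef n p" and "bcirc (tsqrt A) * bcirc (tsqrt A) = bcirc A"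
proof -
  let ?N = "n * p" and ?P = "perm_mat (n * p) (block_shift n p)"
  have At: "A \<in> tensors n n p" and Apd: "posdef_mat ?N (bcirc A)"
    using A t_posdef_iff_bcirc[OF np] by auto
  obtain M where M: "posdef_mat ?N M" "M * M = bcirc A"
    using posdef_sqrt_exists[OF Apd] by blast
  note Mc = posdef_matD(1)[OF M(1)]
  have "?P M * ?P M = M * M"
    using perm_mat_mult[OF bij_betw_block_shift[OF np] Mc Mc] M(2) block_circulant_bcirc[OF np At]
    by (simp add: block_circulant_def)
  then have "?P M = M"
    by (rule posdef_sqrt_unique[OF posdef_perm_mat[OF bij_betw_block_shift[OF np] M(1)] M(1)])
  then obtain S where S: "S \<in> t_posdef n p" "bcirc S = M"
    using t_posdef_obtain[OF np M(1)] by blast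
  then have St: "S \<in> tensors n n p" using t_posdef_iff_bcirc[OF np] by blast
  have "S *\<^sub>T S = A"
    using bcirc_inj[OF np tprod_tensors[OF St St np(2)] At] bcirc_tprod[OF np St St] S M by simp
  then have "tsqrt A = S" by (rule tsqrt_eqI[OF np At S(1)])
  then show "tsqrt A \<in> t_posdef n p" "bcirc (tsqrt A) * bcirc (tsqrt A) = bcirc A"
    using S M by auto
qed

lemma t_posdef_congruence:
  assumes np: "0 < n" "0 < p" and M: "M \<in> t_posdef n p" and R: "R \<in> t_posdef n p"
  shows "R *\<^sub>T M *\<^sub>T R \<in> t_posdef n p"
proof -
  have t: "M \<in> tensors n n p" "R \<in> tensors n n p"
    and pd: "posdef_mat (n * p) (bcirc M)" "posdef_mat (n * p) (bcirc R)"
    using M R t_posdef_iff_bcirc[OF np] by auto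
  obtain V where V: "posdef_mat (n * p) V" "V * bcirc R = 1\<^sub>m (n * p)"
    using posdef_mat_inverse[OF pd(2)] by blast
  have "posdef_mat (n * p) (mat_adjoint (bcirc R) * bcirc M * bcirc R)"
    by (rule posdef_mat_congruence[OF pd(1) posdef_matD(1)[OF pd(2)] posdef_matD(1)[OF V(1)] V(2)])
  then have "posdef_mat (n * p) (bcirc R * bcirc M * bcirc R)"
    using posdef_matD(2)[OF pd(2)] by simp
  then show ?thesis
    using t t_posdef_iff_bcirc[OF np]
    by (simp add: bcirc_tprod[OF np] tprod_tensors[of _ n n p _ n, OF _ _ np(2)])
qed

section \<open>The Riccati equation\<close>

theorem proposition3p2:
  fixes n p :: nat and A B :: ctensor
  assumes "n > 0" and "p > 0"
    and "A \<in> t_posdef n p" and "B \<in> t_posdef n p"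
  shows "A #\<^sub>T B \<in> t_posdef n p
    \<and> (A #\<^sub>T B) *\<^sub>T tinv A *\<^sub>T (A #\<^sub>T B) = B
    \<and> (\<forall>X \<in> t_posdef n p. X *\<^sub>T tinv A *\<^sub>T X = B \<longrightarrow> X = A #\<^sub>T B)"
proof -
  note np = assms(1,2) and A = assms(3) and B = assms(4)
  let ?N = "n * p"
  define R where "R = tsqrt A"
  define R' where "R' = tinv R"
  define C where "C = R' *\<^sub>T B *\<^sub>T R'"
  define T where "T = tsqrt C"
  have R: "R \<in> t_posdef n p" and RR: "bcirc R * bcirc R = bcirc A"
    using t_posdef_tsqrt[OF np A] by (auto simp: R_def)
  have R': "R' \<in> t_posdef n p" and RR': "bcirc R * bcirc R' = 1\<^sub>m ?N"
    and R'R: "bcirc R' * bcirc R = 1\<^sub>m ?N"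
    using t_posdef_tinv[OF np R] by (auto simp: R'_def)
  have C: "C \<in> t_posdef n p" unfolding C_def by (rule t_posdef_congruence[OF np B R'])
  have T: "T \<in> t_posdef n p" and TT: "bcirc T * bcirc T = bcirc C"
    using t_posdef_tsqrt[OF np C] by (auto simp: T_def)
  have G_eq: "A #\<^sub>T B = R *\<^sub>T T *\<^sub>T R"
    by (simp add: tgmean_def Let_def R_def R'_def C_def T_def)
  have G: "A #\<^sub>T B \<in> t_posdef n p" unfolding G_eq by (rule t_posdef_congruence[OF np T R])
  have in_tensors: "X \<in> tensors n n p" if "X \<in> t_posdef n p" for X
    using that t_posdef_iff_bcirc[OF np] by blast
  note tens = in_tensors[OF A] in_tensors[OF B] in_tensors[OF R] in_tensors[OF R']
    in_tensors[OF T] in_tensors[OF C]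
  note carr = bcirc_carrier[OF tens(1) np(2)] bcirc_carrier[OF tens(2) np(2)]
    bcirc_carrier[OF tens(3) np(2)] bcirc_carrier[OF tens(4) np(2)]
    bcirc_carrier[OF tens(5) np(2)]
  note bcirc_mult = bcirc_tprod[OF np] tprod_tensors[of _ n n p _ n, OF _ _ np(2)]
  note assoc = assoc_mult_mat[of _ ?N ?N _ ?N _ ?N] mult_carrier_mat[of _ ?N ?N _ ?N]
  have cancel: "bcirc R * (bcirc R' * Y) = Y" "bcirc R' * (bcirc R * Y) = Y"
    if "Y \<in> carrier_mat ?N ?N" for Y
    using assoc_mult_mat[OF carr(3,4) that] assoc_mult_mat[OF carr(4,3) that] RR' R'R that
    by auto
  \<comment> \<open>Since \<open>A = R * R\<close>; this is the form in which \<open>A\<^sup>-\<^sup>1\<close> cancels against \<open>R\<close> and \<open>R'\<close> below.\<close>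
  have "tinv A = R' *\<^sub>T R'"
  proof (rule tinv_eqI[OF np tens(1)])
    show "R' *\<^sub>T R' \<in> tensors n n p" using tens by (simp add: bcirc_mult)
    show "bcirc A * bcirc (R' *\<^sub>T R') = 1\<^sub>m ?N"
      unfolding RR[symmetric] using tens carr by (simp add: bcirc_mult assoc cancel RR')
    show "bcirc (R' *\<^sub>T R') * bcirc A = 1\<^sub>m ?N"
      unfolding RR[symmetric] using tens carr by (simp add: bcirc_mult assoc cancel R'R)
  qed
  then have invA: "bcirc (tinv A) = bcirc R' * bcirc R'" and invA_tens: "tinv A \<in> tensors n n p"
    using tens by (simp_all add: bcirc_mult)
  have bcC: "bcirc C = bcirc R' * bcirc B * bcirc R'"
    unfolding C_def using tens by (simp add: bcirc_mult)
  have bcG: "bcirc (A #\<^sub>T B) = bcirc R * bcirc T * bcirc R"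
    unfolding G_eq using tens by (simp add: bcirc_mult)
  have "(A #\<^sub>T B) *\<^sub>T tinv A *\<^sub>T (A #\<^sub>T B) = B"
  proof (rule bcirc_inj[OF np _ tens(2)])
    show "(A #\<^sub>T B) *\<^sub>T tinv A *\<^sub>T (A #\<^sub>T B) \<in> tensors n n p"
      using in_tensors[OF G] invA_tens by (simp add: bcirc_mult)
    \<comment> \<open>The mean is \<open>R * T * R\<close>, and the factor \<open>R * A\<^sup>-\<^sup>1 * R = R * R' * R' * R\<close> in the middle cancels.\<close>
    have "bcirc ((A #\<^sub>T B) *\<^sub>T tinv A *\<^sub>T (A #\<^sub>T B)) = bcirc R * (bcirc T * bcirc T) * bcirc R"
      using in_tensors[OF G] invA_tens carr by (simp add: bcirc_mult bcG invA assoc cancel)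
    also have "\<dots> = bcirc B"
      unfolding TT bcC using carr by (simp add: assoc cancel R'R)
    finally show "bcirc ((A #\<^sub>T B) *\<^sub>T tinv A *\<^sub>T (A #\<^sub>T B)) = bcirc B" .
  qed
  moreover have "X = A #\<^sub>T B" if X: "X \<in> t_posdef n p" and eq: "X *\<^sub>T tinv A *\<^sub>T X = B" for X
  proof -
    \<comment> \<open>Undo the substitution \<open>X = R * Y * R\<close>; the equation for \<open>X\<close> makes \<open>Y\<close> a square root of \<open>C\<close>.\<close>
    define Y where "Y = R' *\<^sub>T X *\<^sub>T R'"
    have Y: "Y \<in> t_posdef n p" unfolding Y_def by (rule t_posdef_congruence[OF np X R'])
    note Xt = in_tensors[OF X] and Yt = in_tensors[OF Y]
    note Xc = bcirc_carrier[OF Xt np(2)]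
    have bcY: "bcirc Y = bcirc R' * bcirc X * bcirc R'"
      unfolding Y_def using tens Xt by (simp add: bcirc_mult)
    have bcB: "bcirc B = bcirc X * bcirc (tinv A) * bcirc X"
      using eq Xt invA_tens by (auto simp: bcirc_mult)
    have "bcirc (Y *\<^sub>T Y) = bcirc C"
      using Yt carr Xc by (simp add: bcirc_mult bcY bcC bcB invA assoc)
    then have "Y *\<^sub>T Y = C"
      using bcirc_inj[OF np _ tens(6)] Yt by (simp add: bcirc_mult)
    then have "Y = T"
      unfolding T_def by (rule tsqrt_eqI[OF np tens(6) Y, symmetric])
    then have "bcirc (A #\<^sub>T B) = bcirc R * bcirc Y * bcirc R" using bcG by simp
    also have "\<dots> = bcirc X" unfolding bcY using carr Xc by (simp add: assoc cancel R'R)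
    finally show "X = A #\<^sub>T B" using bcirc_inj[OF np Xt in_tensors[OF G]] by simp
  qed
  ultimately show ?thesis using G by blast
qed

end
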